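(* Let $n>1$ be an odd positive integer. Then \[ \sum_{k=0}^{\frac{n+1}2}[4k-1]\frac{(aq^{-1};q^2)_k(q^{-1}/a;q^2)_k(q^{-1};q^2)_k^2} {(aq^2;q^2)_k(q^2/a;q^2)_k(q^2;q^2)_k^2} q^{4k} \equiv 0 \pmod{[n]^2(1-aq^n)(a-q^n)}, \] and \[ \sum_{k=0}^{n-1}[4k-1]\frac{(aq^{-1};q^2)_k(q^{-1}/a;q^2)_k(q^{-1};q^2)_k^2} {(aq^2;q^2)_k(q^2/a;q^2)_k(q^2;q^2)_k^2} q^{4k} \equiv 0 \pmod{[n]^2(1-aq^n)(a-q^n)}. \]
   Context: Here $q$ and $a$ are indeterminates. The $q$-shifted factorial is $(x;q)_k=(1-x)(1-xq)\cdots(1-xq^{k-1})$ (with $(x;q)_0=1$). For an integer $m$, $[m]=\frac{1-q^m}{1-q}$ (so $[m]=1+q+\cdots+q^{m-1}$ for $m\ge1$). For rational functions $A,B$ in $q,a$ and a polynomial $P$ in $q,a$, $A\equiv B\pmod P$ means that $A-B$ can be written as a quotient of polynomials whose numerator is divisible by $P$ and whose denominator is coprime to $P$. *)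

theory Defs
  imports "HOL-Computational_Algebra.Computational_Algebra"
begin

text \<open>
  Polynomials in the indeterminates \<open>q\<close>, \<open>a\<close> over the rationals are modelled as \<open>rat poly poly\<close>:
  the inner variable is \<open>q\<close>, the outer one is \<open>a\<close>. Rational functions in \<open>q\<close>, \<open>a\<close> are the
  elements of the fraction field \<open>rat poly poly fract\<close>.
\<close>

type_synonym qa_poly = "rat poly poly"
type_synonym qa_ratfun = "rat poly poly fract"

definition q_poly :: qa_poly where
  "q_poly = [:[:0, 1:]:]"

definition a_poly :: qa_poly where
  "a_poly = [:0, 1:]"

definition q_var :: qa_ratfun where
  "q_var = to_fract q_poly"

definition a_var :: qa_ratfun where
  "a_var = to_fract a_poly"

definition qshift :: "'a :: comm_ring_1 \<Rightarrow> 'a \<Rightarrow> nat \<Rightarrow> 'a" where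
  "qshift x q k = (\<Prod>i<k. 1 - x * q ^ i)"

definition qbracket :: "int \<Rightarrow> qa_ratfun" where
  "qbracket m = (1 - q_var powi m) / (1 - q_var)"

text \<open>
  A modulus has to be a polynomial, so for \<open>n \<ge> 1\<close> the polynomial \<open>[n]\<close> is also given in
  \<open>qa_poly\<close>; \<open>to_fract_qbracket_poly\<close> below identifies it with \<open>qbracket n\<close>.
\<close>

definition qbracket_poly :: "nat \<Rightarrow> qa_poly" where
  "qbracket_poly n = (\<Sum>i<n. q_poly ^ i)"

definition ratfun_cong :: "qa_ratfun \<Rightarrow> qa_ratfun \<Rightarrow> qa_poly \<Rightarrow> bool" where
  "ratfun_cong A B P \<longleftrightarrow>
     (\<exists>u v. v \<noteq> 0 \<and> A - B = to_fract u / to_fract v \<and> P dvd u \<and> coprime v P)"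

definition summand :: "nat \<Rightarrow> qa_ratfun" where
  "summand k = qbracket (4 * int k - 1) *
     (qshift (a_var * inverse q_var) (q_var ^ 2) k * qshift (inverse q_var / a_var) (q_var ^ 2) k *
        qshift (inverse q_var) (q_var ^ 2) k ^ 2) /
     (qshift (a_var * q_var ^ 2) (q_var ^ 2) k * qshift (q_var ^ 2 / a_var) (q_var ^ 2) k *
        qshift (q_var ^ 2) (q_var ^ 2) k ^ 2) *
     q_var ^ (4 * k)"

lemma q_var_neq_1: "q_var \<noteq> 1"
proof
  assume "q_var = 1"
  then have "to_fract q_poly = to_fract 1" by (simp add: q_var_def)
  then have "q_poly = 1" by (simp only: to_fract_eq_iff)
  then show False by (simp add: q_poly_def one_pCons)
qed

lemma to_fract_power': "to_fract (x ^ n) = to_fract x ^ n"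
  by (induction n) simp_all

lemma to_fract_sum': "to_fract (\<Sum>i<n. f i) = (\<Sum>i<(n :: nat). to_fract (f i))"
  by (induction n) simp_all

lemma to_fract_qbracket_poly: "to_fract (qbracket_poly n) = qbracket (int n)"
proof -
  have "(1 - q_var) * (\<Sum>i<n. q_var ^ i) = 1 - q_var ^ n"
    by (rule one_diff_power_eq [symmetric])
  then show ?thesis
    using q_var_neq_1
    by (simp add: qbracket_poly_def qbracket_def q_var_def [symmetric] to_fract_power'
        to_fract_sum' field_simps)
qed

end

theory Submission
  imports Defs "HOL-Computational_Algebra.Field_as_Ring"
begin

text \<open>
  The summands are indefinitely summable for every \<open>a\<close>: the sum up to \<open>k = M\<close> equals
  \[ \frac{a(1+q)(y^2+q^3)-q^2(1+a)^2y}{y^2(1-aq)(q-a)}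
     \prod_{i=1}^{M}\frac{(q-aq^{2i})(aq-q^{2i})(q-q^{2i})^2}{(1-aq^{2i})(a-q^{2i})(1-q^{2i})^2},
     \qquad y=q^{2M+2}. \]
  For \<open>M \<ge> (n + 1) / 2\<close> the factor \<open>i = (n + 1) / 2\<close> of the numerator supplies
  \<open>(1 - a q^n) (a - q^n)\<close>. The product of the \<open>(1 - q^(2i-1)) / (1 - q^(2i))\<close> is the
  \<open>q\<close>-binomial coefficient \<open>(2M choose M)\<close> divided by the square of a product of factors
  \<open>1 + q^i\<close>, which are coprime to \<open>[n]\<close> for odd \<open>n\<close>; and \<open>[n]\<close> divides this
  \<open>q\<close>-binomial coefficient for both values of \<open>M\<close>, which gives \<open>[n]^2\<close>.
\<close>

section \<open>Telescoping and the closed form of the partial sums\<close>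

definition num_factor :: "'a :: comm_ring_1 \<Rightarrow> 'a \<Rightarrow> 'a \<Rightarrow> 'a" where
  "num_factor q a y = (q - a * y) * (a * q - y) * (q - y) ^ 2"

definition den_factor :: "'a :: comm_ring_1 \<Rightarrow> 'a \<Rightarrow> 'a" where
  "den_factor a y = (1 - a * y) * (a - y) * (1 - y) ^ 2"

text \<open>The telescoping certificate: the part of the closed form that is not a product, cleared
  of its denominator \<open>y ^ 2 * (1 - a * q) * (q - a)\<close>, at
  \<open>y = q ^ (2 * M + 2)\<close>.\<close>

definition cert :: "'a :: comm_ring_1 \<Rightarrow> 'a \<Rightarrow> 'a \<Rightarrow> 'a" where
  "cert q a y = a * (1 + q) * (y ^ 2 + q ^ 3) - q ^ 2 * (1 + a) ^ 2 * y"

text \<open>This is the difference of two consecutive closed forms after clearing denominators. The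
  map from \<open>y\<close> to \<open>q ^ 2 * y\<close> advances \<open>M\<close> by one, and
  \<open>q ^ 4\<close> comes from the denominator \<open>y ^ 2\<close>. The right-hand side is the
  new summand up to the common denominator.\<close>

lemma cert_step:
  fixes q a y :: "'a :: idom"
  shows "cert q a (q ^ 2 * y) * num_factor q a y - q ^ 4 * cert q a y * den_factor a y =
    q ^ 3 * y ^ 2 * (q - y ^ 2) * ((q - a) * (1 - a * q)) ^ 2 * (q - 1)"
  unfolding cert_def num_factor_def den_factor_def by algebra

lemma cert_base:
  fixes q a :: "'a :: idom"
  shows "cert q a (q ^ 2) = - (q ^ 3 * ((1 - a * q) * (q - a)))"
  unfolding cert_def by algebra

lemma partial_sum_closed_form:
  fixes q a :: "'a :: field"
  assumes "q \<noteq> 0" "q \<noteq> 1" "1 - a * q \<noteq> 0" "q - a \<noteq> 0"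
    and den: "\<And>i. den_factor a (q ^ (2 * i + 2)) \<noteq> 0"
  shows "(\<Sum>k = 0..M. (q - q ^ (4 * k)) / (q * (1 - q)) *
             (\<Prod>i<k. num_factor q a (q ^ (2 * i)) / den_factor a (q ^ (2 * i + 2)))) =
         cert q a (q ^ (2 * M + 2)) / (q ^ (4 * M + 4) * ((1 - a * q) * (q - a))) *
             (\<Prod>i<M. num_factor q a (q ^ (2 * i + 2)) / den_factor a (q ^ (2 * i + 2)))"
proof (induction M)
  case 0
  define c where "c = (1 - a * q) * (q - a)"
  have "c \<noteq> 0" using assms by (simp add: c_def)
  moreover have "(q - 1) / (q * (1 - q)) = - (q ^ 3 * c) / (q ^ 4 * c)"
    using assms(1,2) \<open>c \<noteq> 0\<close> by (simp add: divide_simps) algebra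
  ultimately show ?case
    using cert_base[of q a] by (simp add: c_def flip: power2_eq_square)
next
  case (Suc M)
  define P where "P = (\<Prod>i<M. num_factor q a (q ^ (2 * i + 2)) / den_factor a (q ^ (2 * i + 2)))"
  define y where "y = q ^ (2 * M + 2)"
  define c where "c = (1 - a * q) * (q - a)"
  define N where "N = num_factor q a y"
  define D where "D = den_factor a y"
  have nz: "y \<noteq> 0" "c \<noteq> 0" "D \<noteq> 0" "1 - q \<noteq> 0"
    using assms by (auto simp: y_def c_def D_def)
  \<comment> \<open>The numerators of the summand lag one index behind those of \<open>P\<close>:
    the factor at \<open>i = 0\<close>, that is at \<open>y = 1\<close>, splits off and the
    remaining ones are those of \<open>P\<close>.\<close>
  have prods: "(\<Prod>i<Suc M. num_factor q a (q ^ (2 * i)) / den_factor a (q ^ (2 * i + 2))) =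
      num_factor q a 1 * P / D"
  proof -
    have "(\<Prod>i<Suc M. num_factor q a (q ^ (2 * i))) =
        num_factor q a 1 * (\<Prod>i<M. num_factor q a (q ^ (2 * i + 2)))"
      by (subst prod.lessThan_Suc_shift) simp
    then show ?thesis
      unfolding P_def D_def y_def prod_dividef by simp
  qed
  have pows: "q ^ (4 * Suc M) = y ^ 2" "q ^ (4 * M + 4) = y ^ 2"
      "q ^ (2 * Suc M + 2) = q ^ 2 * y" "q ^ (4 * Suc M + 4) = q ^ 4 * y ^ 2"
  proof -
    have e: "4 * Suc M = (2 * M + 2) * 2" "4 * M + 4 = (2 * M + 2) * 2"
        "2 * Suc M + 2 = 2 + (2 * M + 2)" "4 * Suc M + 4 = 4 + (2 * M + 2) * 2"
      by simp_all
    show "q ^ (4 * Suc M) = y ^ 2" "q ^ (4 * M + 4) = y ^ 2"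
        "q ^ (2 * Suc M + 2) = q ^ 2 * y" "q ^ (4 * Suc M + 4) = q ^ 4 * y ^ 2"
      by (simp_all only: y_def e power_mult[of q "2 * M + 2" 2] power_add[of q 2 "2 * M + 2"]
          power_add[of q 4 "(2 * M + 2) * 2"] add.commute[of "(2 * M + 2) * 2" 4])
  qed
  have N1: "num_factor q a 1 = - c * (1 - q) ^ 2"
    unfolding num_factor_def c_def by algebra
  have step: "cert q a (q ^ 2 * y) * N = q ^ 4 * cert q a y * D +
      q ^ 3 * y ^ 2 * (q - y ^ 2) * c ^ 2 * (q - 1)"
    using cert_step[of q a y] unfolding N_def D_def c_def by algebra
  \<comment> \<open>By \<open>N1\<close> the split-off factor is \<open>- c * (1 - q) ^ 2\<close>.
    Over the common denominator \<open>q ^ 4 * y ^ 2 * c * D\<close> the new summand then becomes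
    the inhomogeneous term of \<open>step\<close>.\<close>
  have "cert q a y / (y ^ 2 * c) * P + (q - y ^ 2) / (q * (1 - q)) * (num_factor q a 1 * P / D) =
      (q ^ 4 * cert q a y * D + q ^ 3 * y ^ 2 * (q - y ^ 2) * c ^ 2 * (q - 1)) /
        (q ^ 4 * y ^ 2 * c) * (P / D)"
    unfolding N1 using nz assms(1)
    by (simp add: divide_simps) algebra
  also have "\<dots> = cert q a (q ^ 2 * y) / (q ^ 4 * y ^ 2 * c) * (P * (N / D))"
    unfolding step[symmetric] by simp
  finally show ?case
    using Suc.IH
    unfolding sum.atLeast0_atMost_Suc prods pows
    by (simp add: P_def y_def N_def D_def c_def)
qed

text \<open>Each index \<open>i\<close> multiplies numerator and denominator of the shifted
  factorials by \<open>a\<close>, and the numerator also by \<open>q ^ 4\<close>. This removes the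
  inverses of \<open>q\<close> and \<open>a\<close> and uses up exactly the weight
  \<open>q ^ (4 * k)\<close>.\<close>

lemma summand_eq:
  "summand k = (q_var - q_var ^ (4 * k)) / (q_var * (1 - q_var)) *
     (\<Prod>i<k. num_factor q_var a_var (q_var ^ (2 * i)) / den_factor a_var (q_var ^ (2 * i + 2)))"
proof -
  have nz: "q_var \<noteq> 0" "a_var \<noteq> 0"
    by (simp_all add: q_var_def a_var_def q_poly_def a_poly_def)
  have br: "qbracket (4 * int k - 1) = (q_var - q_var ^ (4 * k)) / (q_var * (1 - q_var))"
  proof -
    have "q_var powi (4 * int k - 1) = q_var ^ (4 * k) / q_var"
      using nz power_int_diff[of q_var "4 * int k" 1] power_int_of_nat[of q_var "4 * k"] by simp
    then show ?thesis
      unfolding qbracket_def using nz by (simp add: diff_divide_distrib)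
  qed
  have fac: "num_factor q_var a_var (q_var ^ (2 * i)) / den_factor a_var (q_var ^ (2 * i + 2)) =
     (1 - a_var * inverse q_var * (q_var ^ 2) ^ i) * (1 - inverse q_var / a_var * (q_var ^ 2) ^ i) *
        (1 - inverse q_var * (q_var ^ 2) ^ i) ^ 2 /
     ((1 - a_var * q_var ^ 2 * (q_var ^ 2) ^ i) * (1 - q_var ^ 2 / a_var * (q_var ^ 2) ^ i) *
        (1 - q_var ^ 2 * (q_var ^ 2) ^ i) ^ 2) * q_var ^ 4" for i
  proof -
    define z where "z = q_var ^ (2 * i)"
    have z: "(q_var ^ 2) ^ i = z" "q_var ^ (2 * i + 2) = q_var ^ 2 * z"
      by (simp_all add: z_def power_mult power_add flip: power2_eq_square)
    have N: "num_factor q_var a_var z = a_var * (((1 - a_var * inverse q_var * z) *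
        (1 - inverse q_var / a_var * z) * (1 - inverse q_var * z) ^ 2) * q_var ^ 4)"
      unfolding num_factor_def using nz by (simp add: divide_simps) algebra
    have D: "den_factor a_var (q_var ^ 2 * z) = a_var * ((1 - a_var * q_var ^ 2 * z) *
        (1 - q_var ^ 2 / a_var * z) * (1 - q_var ^ 2 * z) ^ 2)"
      unfolding den_factor_def using nz by (simp add: field_simps)
    show ?thesis
      unfolding z z_def[symmetric] N D using nz by simp
  qed
  show ?thesis
    unfolding summand_def br fac qshift_def prod.distrib prod_dividef prod_power_distrib
    by (simp add: power_mult)
qed

section \<open>Coprimality of polynomials by elimination of the outer variable\<close>

lemma coprime_const_poly:
  fixes c :: "'a :: {idom_divide, algebraic_semidom}"
  assumes "c \<noteq> 0" "is_unit (coeff f k)"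
  shows "coprime [:c:] f"
proof (rule coprimeI)
  fix g assume g: "g dvd [:c:]" "g dvd f"
  \<comment> \<open>A divisor of a nonzero constant is a constant, so it divides every coefficient
    of \<open>f\<close>, among them the unit.\<close>
  then have "degree g = 0"
    using dvd_imp_degree_le[of g "[:c:]"] assms by simp
  then obtain g0 where "g = [:g0:]" by (rule degree_eq_zeroE)
  with g have "g0 dvd coeff f k" by (simp add: const_poly_dvd_iff)
  then have "is_unit g0" using assms(2) dvd_trans by blast
  then show "is_unit g" using \<open>g = [:g0:]\<close> by (simp add: is_unit_const_poly_iff)
qed

text \<open>A combination of \<open>f\<close> and \<open>g\<close> that is free of the outer
  variable acts like a resultant: common divisors divide the constant \<open>c\<close>, to which
  \<open>f\<close> is coprime by its unit coefficient.\<close>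

lemma coprime_poly_elim:
  fixes f g :: "'a :: {idom_divide, algebraic_semidom} poly"
  assumes "u * f + v * g = [:c:]" "c \<noteq> 0" "is_unit (coeff f k)"
  shows "coprime f g"
proof (rule coprimeI)
  fix h assume h: "h dvd f" "h dvd g"
  then have "h dvd [:c:]" by (simp flip: assms(1))
  then show "is_unit h"
    using coprime_const_poly[OF assms(2,3)] h(1) coprime_common_divisor by blast
qed

section \<open>q-factorials \<open>(q;q)_m\<close> and q-binomial coefficients\<close>

definition qfac :: "'a :: comm_ring_1 \<Rightarrow> nat \<Rightarrow> 'a" where
  "qfac q m = (\<Prod>i<m. 1 - q ^ Suc i)"

lemma qfac_Suc: "qfac q (Suc m) = qfac q m * (1 - q ^ Suc m)"
  by (simp add: qfac_def)

lemma qfac_mult_dvd: "qfac q k * qfac q m dvd qfac q (k + m)"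
proof (induction "k + m" arbitrary: k m)
  case 0
  then show ?case by (simp add: qfac_def)
next
  case (Suc s)
  show ?case
  proof (cases "k = 0 \<or> m = 0")
    case True
    then show ?thesis by (auto simp: qfac_def)
  next
    case False
    then obtain k' m' where km: "k = Suc k'" "m = Suc m'"
      by (auto simp: gr0_conv_Suc)
    have s: "s = k' + m" "s = k + m'" using Suc.hyps(2) km by auto
    obtain b where b: "qfac q s = qfac q k' * qfac q m * b"
      using Suc.hyps(1)[OF s(1)] s(1) by (auto elim: dvdE)
    obtain c where c: "qfac q s = qfac q k * qfac q m' * c"
      using Suc.hyps(1)[OF s(2)] s(2) by (auto elim: dvdE)
    have "qfac q (k + m) = qfac q s * (1 - q ^ (k + m))"
      using qfac_Suc[of q s] Suc.hyps(2) by simp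
    also have "\<dots> = qfac q s * (1 - q ^ k) + qfac q s * (q ^ k * (1 - q ^ m))"
      by (simp add: power_add algebra_simps)
    also have "qfac q s * (1 - q ^ k) = qfac q k * qfac q m * b"
      unfolding b km qfac_Suc by (simp only: ac_simps)
    also have "qfac q s * (q ^ k * (1 - q ^ m)) = qfac q k * qfac q m * (c * q ^ k)"
      unfolding c km qfac_Suc by (simp only: ac_simps)
    finally show ?thesis by simp
  qed
qed

lemma qfac_double:
  "qfac q (2 * M) = (\<Prod>i<M. 1 - q ^ (2 * i + 1)) * (\<Prod>i<M. 1 - q ^ (2 * i + 2))"
  by (induction M) (simp_all add: qfac_Suc, simp add: qfac_def ac_simps)

lemma one_diff_power_double: "1 - q ^ (2 * m) = (1 - q ^ m) * (1 + (q :: 'a :: comm_ring_1) ^ m)"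
  by (subst mult_2) (simp only: power_add algebra_simps, simp)

lemma prod_even_eq:
  "(\<Prod>i<M. 1 - q ^ (2 * i + 2)) = qfac q M * (\<Prod>i<M. 1 + (q :: 'a :: comm_ring_1) ^ Suc i)"
proof -
  have "1 - q ^ (2 * i + 2) = (1 - q ^ Suc i) * (1 + q ^ Suc i)" for i
    using one_diff_power_double[of q "Suc i"] by simp
  then show ?thesis by (simp only: qfac_def prod.distrib)
qed

text \<open>The factors \<open>1 - q ^ (2 * i + 2)\<close> may share divisors with
  \<open>[n]\<close>, so they have to leave the denominator. If \<open>x\<close> and
  \<open>y\<close> are the products over odd and even exponents, then \<open>x * y\<close> is
  \<open>qfac q (2 * M)\<close> and \<open>y = qfac q M * g M\<close>, whence
  \<open>x / y = b / g M ^ 2\<close>.\<close>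

lemma prod_num_den:
  fixes q a b :: "'a :: field"
  defines "g \<equiv> \<lambda>M. \<Prod>i<M. 1 + q ^ Suc i"
  assumes b: "qfac q (2 * M) = qfac q M * qfac q M * b"
    and nz: "qfac q M \<noteq> 0" "g M \<noteq> 0"
  shows "(\<Prod>i<M. num_factor q a (q ^ (2 * i + 2)) / den_factor a (q ^ (2 * i + 2))) =
    q ^ (2 * M) * (\<Prod>i<M. (q - a * q ^ (2 * i + 2)) * (a * q - q ^ (2 * i + 2))) * b ^ 2 /
    ((\<Prod>i<M. (1 - a * q ^ (2 * i + 2)) * (a - q ^ (2 * i + 2))) * g M ^ 4)"
proof -
  define x where "x = (\<Prod>i<M. 1 - q ^ (2 * i + 1))"
  define y where "y = (\<Prod>i<M. 1 - q ^ (2 * i + 2))"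
  have y: "y = qfac q M * g M"
    unfolding y_def g_def by (rule prod_even_eq)
  have "x * y = qfac q M * qfac q M * b"
    using b qfac_double[of q M] by (simp add: x_def y_def)
  then have xy: "x / y = b / g M ^ 2"
    using nz unfolding y by (simp add: divide_simps power2_eq_square)
  have "num_factor q a (q ^ (2 * i + 2)) =
      (q - a * q ^ (2 * i + 2)) * (a * q - q ^ (2 * i + 2)) * (q ^ 2 * (1 - q ^ (2 * i + 1)) ^ 2)" for i
    unfolding num_factor_def by (simp add: power2_eq_square algebra_simps)
  then have "(\<Prod>i<M. num_factor q a (q ^ (2 * i + 2)) / den_factor a (q ^ (2 * i + 2))) =
      q ^ (2 * M) * (\<Prod>i<M. (q - a * q ^ (2 * i + 2)) * (a * q - q ^ (2 * i + 2))) /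
      (\<Prod>i<M. (1 - a * q ^ (2 * i + 2)) * (a - q ^ (2 * i + 2))) * (x / y) ^ 2"
    unfolding den_factor_def x_def y_def prod_dividef prod.distrib prod_power_distrib[symmetric]
    by (simp add: prod.distrib power_divide power_mult flip: prod_power_distrib)
  then show ?thesis
    unfolding xy by (simp add: power_divide flip: power_mult)
qed

section \<open>Powers of q, \<open>[n]\<close> and the linear factors as polynomials in a\<close>

lemma to_fract_prod: "to_fract (\<Prod>i<M. f i) = (\<Prod>i<(M :: nat). to_fract (f i))"
  by (induction M) simp_all

lemma q_poly_power: "q_poly ^ i = [:monom 1 i:]"
  by (induction i) (simp_all add: q_poly_def one_pCons monom_Suc)

lemma q_poly_power_eq_iff: "q_poly ^ i = q_poly ^ j \<longleftrightarrow> i = j"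
  by (simp add: q_poly_power monom_eq_iff')

lemma one_diff_q_poly_power: "1 - q_poly ^ n = (1 - q_poly) * qbracket_poly n"
  unfolding qbracket_poly_def by (rule one_diff_power_eq)

lemma one_diff_q_poly_power_neq_0: "n > 0 \<Longrightarrow> 1 - q_poly ^ n \<noteq> 0"
  using q_poly_power_eq_iff[of 0 n] by auto

lemma qbracket_poly_const: "n > 0 \<Longrightarrow> \<exists>c. c \<noteq> 0 \<and> qbracket_poly n = [:c:]"
proof (intro exI conjI)
  have "qbracket_poly n = [:\<Sum>i<n. monom 1 i:]"
    unfolding qbracket_poly_def q_poly_power by (induction n) simp_all
  then show *: "qbracket_poly n = [:coeff (qbracket_poly n) 0:]" by simp
  assume "n > 0"
  then have "qbracket_poly n \<noteq> 0"
    using one_diff_q_poly_power_neq_0[of n] by (auto simp: one_diff_q_poly_power)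
  then show "coeff (qbracket_poly n) 0 \<noteq> 0"
    using * by auto
qed

text \<open>These are the unit coefficients that \<open>coprime_const_poly\<close> and
  \<open>coprime_poly_elim\<close> ask for.\<close>

lemma coeff_lin: "coeff (1 - a_poly * q_poly ^ i) 0 = 1" "coeff (a_poly - q_poly ^ i) (Suc 0) = 1"
  by (simp_all add: a_poly_def q_poly_power)

section \<open>Coprimality to the factors of the modulus\<close>

definition modulus_coprime :: "nat \<Rightarrow> qa_poly \<Rightarrow> bool" where
  "modulus_coprime m v \<longleftrightarrow>
     coprime v (qbracket_poly m) \<and> coprime v (1 - a_poly * q_poly ^ m) \<and> coprime v (a_poly - q_poly ^ m)"

context
  fixes n :: nat
  assumes n: "n > 1" "odd n"
begin

lemma coprime_q_qbracket: "coprime q_poly (qbracket_poly n)"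
proof (rule coprimeI)
  fix c assume c: "c dvd q_poly" "c dvd qbracket_poly n"
  obtain m where "n = Suc m" using n by (cases n) auto
  then have "qbracket_poly n = 1 + q_poly * qbracket_poly m"
    by (simp add: qbracket_poly_def sum.lessThan_Suc_shift sum_distrib_left del: sum.lessThan_Suc)
  with c show "is_unit c" by (metis dvd_add_left_iff dvd_mult2)
qed

lemma modulus_coprime_q: "modulus_coprime n q_poly"
  unfolding modulus_coprime_def
proof (intro conjI)
  show "coprime q_poly (qbracket_poly n)" by (rule coprime_q_qbracket)
  show "coprime q_poly (1 - a_poly * q_poly ^ n)"
    unfolding q_poly_def using coeff_lin(1)[of n, unfolded q_poly_def]
    by (intro coprime_const_poly[where k = 0]) simp_all
  show "coprime q_poly (a_poly - q_poly ^ n)"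
    using coeff_lin(2)[of n] unfolding q_poly_def
    by (intro coprime_const_poly[where k = "Suc 0"]) simp_all
qed

text \<open>For odd \<open>n\<close>, \<open>1 + q ^ i\<close> divides
  \<open>1 + q ^ (i * n)\<close>, while \<open>[n]\<close> divides \<open>1 - q ^ (i * n)\<close>. A
  common divisor therefore divides 2, a unit over the rationals. The linear factors are coprime to
  every nonzero polynomial in q alone.\<close>

lemma modulus_coprime_one_plus:
  assumes "i > 0"
  shows "modulus_coprime n (1 + q_poly ^ i)"
proof -
  have eq: "1 + q_poly ^ i = [:1 + monom 1 i:]"
    by (simp add: q_poly_power one_pCons)
  have "poly (1 + monom 1 i) (1 :: rat) \<noteq> 0" by (simp add: poly_monom)
  then have nz: "(1 + monom 1 i :: rat poly) \<noteq> 0" by force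
  have "coprime (1 + q_poly ^ i) (qbracket_poly n)"
  proof (rule coprimeI)
    fix c assume c: "c dvd 1 + q_poly ^ i" "c dvd qbracket_poly n"
    have "1 + q_poly ^ i dvd 1 + q_poly ^ (i * n)"
    proof -
      have "(- (q_poly ^ i)) ^ n = - (q_poly ^ (i * n))"
        using n by (simp add: power_mult)
      then show ?thesis
        using one_diff_power_eq[of "- (q_poly ^ i)" n] by auto
    qed
    moreover have "1 - q_poly ^ n dvd 1 - q_poly ^ (i * n)"
      using one_diff_power_eq[of "q_poly ^ n" i] by (simp add: mult.commute flip: power_mult)
    moreover have "c dvd 1 - q_poly ^ n"
      using c(2) by (simp add: one_diff_q_poly_power)
    ultimately have "c dvd (1 + q_poly ^ (i * n)) + (1 - q_poly ^ (i * n))"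
      using c(1) by (meson dvd_add dvd_trans)
    then have "c dvd [:[:2:]:]" by (simp add: numeral_poly)
    moreover have "is_unit [:[:2 :: rat:]:]" by (simp add: is_unit_const_poly_iff dvd_field_iff)
    ultimately show "is_unit c" by (rule dvd_trans)
  qed
  then show ?thesis
    unfolding modulus_coprime_def eq
    using coprime_const_poly[OF nz, of _ 0] coprime_const_poly[OF nz, of _ "Suc 0"] coeff_lin[of n]
    by simp
qed

text \<open>Eliminating a from \<open>1 - a * q ^ i\<close> and the two linear factors leaves
  \<open>q ^ n - q ^ i\<close> and \<open>1 - q ^ (n + i)\<close>. The first is nonzero because
  \<open>i\<close> differs from \<open>n\<close>, the second because \<open>n\<close> is
  positive.\<close>

lemma modulus_coprime_one_minus:
  assumes "i \<noteq> n"
  shows "modulus_coprime n (1 - a_poly * q_poly ^ i)"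
  unfolding modulus_coprime_def
proof (intro conjI)
  obtain c where "c \<noteq> 0" "qbracket_poly n = [:c:]"
    using qbracket_poly_const[of n] n by auto
  then show "coprime (1 - a_poly * q_poly ^ i) (qbracket_poly n)"
    using coprime_const_poly[of c "1 - a_poly * q_poly ^ i" 0]
    unfolding coeff_lin coprime_commute[of "1 - a_poly * q_poly ^ i"] by simp
  show "coprime (1 - a_poly * q_poly ^ i) (1 - a_poly * q_poly ^ n)"
  proof (rule coprime_poly_elim)
    show "q_poly ^ n * (1 - a_poly * q_poly ^ i) + (- (q_poly ^ i)) * (1 - a_poly * q_poly ^ n) =
        [:monom 1 n - monom 1 i:]"
      using q_poly_power[of n] q_poly_power[of i] by (simp add: algebra_simps)
    show "monom 1 n - monom 1 i \<noteq> (0 :: rat poly)"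
      using assms by (simp add: monom_eq_iff')
    show "is_unit (coeff (1 - a_poly * q_poly ^ i) 0)" unfolding coeff_lin by simp
  qed
  show "coprime (1 - a_poly * q_poly ^ i) (a_poly - q_poly ^ n)"
  proof (rule coprime_poly_elim)
    show "1 * (1 - a_poly * q_poly ^ i) + q_poly ^ i * (a_poly - q_poly ^ n) =
        [:1 - monom 1 (n + i):]"
      using q_poly_power[of "n + i"] by (simp add: algebra_simps power_add flip: one_pCons)
    show "1 - monom 1 (n + i) \<noteq> (0 :: rat poly)"
      using n by (simp add: monom_eq_iff' flip: monom_eq_1)
    show "is_unit (coeff (1 - a_poly * q_poly ^ i) 0)" unfolding coeff_lin by simp
  qed
qed

lemma modulus_coprime_minus:
  assumes "i \<noteq> n"
  shows "modulus_coprime n (a_poly - q_poly ^ i)"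
  unfolding modulus_coprime_def
proof (intro conjI)
  obtain c where "c \<noteq> 0" "qbracket_poly n = [:c:]"
    using qbracket_poly_const[of n] n by auto
  then show "coprime (a_poly - q_poly ^ i) (qbracket_poly n)"
    using coprime_const_poly[of c "a_poly - q_poly ^ i" "Suc 0"]
    unfolding coeff_lin coprime_commute[of "a_poly - q_poly ^ i"] by simp
  show "coprime (a_poly - q_poly ^ i) (1 - a_poly * q_poly ^ n)"
  proof (rule coprime_poly_elim)
    show "q_poly ^ n * (a_poly - q_poly ^ i) + 1 * (1 - a_poly * q_poly ^ n) =
        [:1 - monom 1 (n + i):]"
      using q_poly_power[of "n + i"] by (simp add: algebra_simps power_add flip: one_pCons)
    show "1 - monom 1 (n + i) \<noteq> (0 :: rat poly)"
      using n by (simp add: monom_eq_iff' flip: monom_eq_1)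
    show "is_unit (coeff (a_poly - q_poly ^ i) (Suc 0))" unfolding coeff_lin by simp
  qed
  show "coprime (a_poly - q_poly ^ i) (a_poly - q_poly ^ n)"
  proof (rule coprime_poly_elim)
    show "1 * (a_poly - q_poly ^ i) + (- 1) * (a_poly - q_poly ^ n) = [:monom 1 n - monom 1 i:]"
      using q_poly_power[of n] q_poly_power[of i] by (simp add: algebra_simps)
    show "monom 1 n - monom 1 i \<noteq> (0 :: rat poly)"
      using assms by (simp add: monom_eq_iff')
    show "is_unit (coeff (a_poly - q_poly ^ i) (Suc 0))" unfolding coeff_lin by simp
  qed
qed

text \<open>The second assumption is a Euclidean step: a common divisor of \<open>[n]\<close> and
  \<open>[k]\<close> divides a power of q, which is coprime to \<open>[n]\<close>. So
  \<open>[k]\<close> can be cancelled.\<close>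

lemma qbracket_dvd_cancel:
  assumes "qbracket_poly k * B = qbracket_poly n * C"
    and "qbracket_poly n = qbracket_poly k * w + q_poly ^ e"
  shows "qbracket_poly n dvd B"
proof -
  have "coprime (qbracket_poly n) (qbracket_poly k)"
  proof (rule coprimeI)
    fix c assume c: "c dvd qbracket_poly n" "c dvd qbracket_poly k"
    then have "c dvd q_poly ^ e"
      using assms(2) by (metis dvd_add_right_iff dvd_mult2)
    moreover have "coprime (q_poly ^ e) (qbracket_poly n)"
      using coprime_q_qbracket by simp
    ultimately show "is_unit c"
      using c(1) coprime_common_divisor by blast
  qed
  moreover have "qbracket_poly n dvd qbracket_poly k * B"
    using assms(1) by simp
  ultimately show ?thesis
    by (simp add: coprime_dvd_mult_right_iff)
qed

end

section \<open>Divisibility of central q-binomial coefficients by \<open>[n]\<close>\<close>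

lemma qfac_q_poly_neq_0: "qfac q_poly m \<noteq> 0"
  using one_diff_q_poly_power_neq_0 by (simp add: qfac_def del: power_Suc)

lemma one_minus_q_poly_neq_0: "1 - q_poly \<noteq> 0"
  using one_diff_q_poly_power_neq_0[of 1] by simp

text \<open>With \<open>C\<close> the q-binomial coefficient (2n-2 choose n), comparing factorials
  gives \<open>[n-1] * B = [n] * C\<close>. Then \<open>[n] = [n-1] + q ^ (n - 1)\<close> allows the
  cancellation.\<close>

lemma qbracket_dvd_binomial_pred:
  assumes "n > 1" "odd n"
    and B: "qfac q_poly (2 * (n - 1)) = qfac q_poly (n - 1) * qfac q_poly (n - 1) * B"
  shows "qbracket_poly n dvd B"
proof -
  obtain m where m: "n = Suc (Suc m)"
    using assms(1) by (metis One_nat_def less_imp_Suc_add add_Suc)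
  obtain C where C: "qfac q_poly (n + m) = qfac q_poly n * qfac q_poly m * C"
    using qfac_mult_dvd by (blast elim: dvdE)
  have "2 * (n - 1) = n + m" using m by simp
  then have "qfac q_poly (n - 1) * qfac q_poly (n - 1) * B = qfac q_poly n * qfac q_poly m * C"
    using B C by simp
  then have "(qfac q_poly m * qfac q_poly (Suc m) * (1 - q_poly)) * (qbracket_poly (Suc m) * B) =
      (qfac q_poly m * qfac q_poly (Suc m) * (1 - q_poly)) * (qbracket_poly n * C)"
    unfolding m diff_Suc_1 qfac_Suc[of _ "Suc m"] one_diff_q_poly_power
    by (simp add: qfac_Suc[of _ m] one_diff_q_poly_power ac_simps del: power_Suc)
  then have "qbracket_poly (Suc m) * B = qbracket_poly n * C"
    using qfac_q_poly_neq_0 one_minus_q_poly_neq_0 by simp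
  then show ?thesis
    by (rule qbracket_dvd_cancel[OF assms(1,2), where w = 1 and e = "Suc m"])
       (simp add: m qbracket_poly_def)
qed

text \<open>Here \<open>2 * M = n + 1\<close>. With \<open>C\<close> the q-binomial coefficient (n-1
  choose M), comparing factorials gives \<open>[M-1] * B = [n] * C * (1 + q ^ M)\<close>. Since
  \<open>n - 1\<close> is twice \<open>M - 1\<close>, \<open>[n]\<close> is a multiple of
  \<open>[M-1]\<close> plus \<open>q ^ (n - 1)\<close>.\<close>

lemma qbracket_dvd_binomial_half:
  assumes n: "n > 1" "odd n"
    and M: "M = (n + 1) div 2"
    and B: "qfac q_poly (2 * M) = qfac q_poly M * qfac q_poly M * B"
  shows "qbracket_poly n dvd B"
proof -
  obtain h where h: "n = 2 * Suc h + 1"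
    using n by (metis One_nat_def Suc_eq_plus1 add_0 gr0_conv_Suc less_irrefl mult_0_right
        neq0_conv oddE)
  have M': "M = Suc (Suc h)" "2 * M = Suc n" "n = Suc (M + h)" using M h by simp_all
  obtain C where C: "qfac q_poly (M + h) = qfac q_poly M * qfac q_poly h * C"
    using qfac_mult_dvd by (blast elim: dvdE)
  have sq: "1 - q_poly ^ Suc n = (1 - q_poly ^ M) * (1 + q_poly ^ M)"
    using one_diff_power_double[of q_poly M] M'(2) by simp
  have "qfac q_poly (2 * M) = qfac q_poly (M + h) * (1 - q_poly ^ n) * (1 - q_poly ^ Suc n)"
    using qfac_Suc[of q_poly n] qfac_Suc[of q_poly "M + h"] unfolding M'(2) M'(3)[symmetric] by simp
  then have "qfac q_poly M * (qfac q_poly M * B) =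
      qfac q_poly M * (qfac q_poly h * C * (1 - q_poly ^ n) * ((1 - q_poly ^ M) * (1 + q_poly ^ M)))"
    unfolding B C sq by (simp only: ac_simps)
  moreover have "qfac q_poly M =
      qfac q_poly h * ((1 - q_poly) * qbracket_poly (Suc h)) * (1 - q_poly ^ M)"
    unfolding M'(1) qfac_Suc one_diff_q_poly_power[of "Suc h"] ..
  ultimately have
    "(qfac q_poly h * (1 - q_poly) * (1 - q_poly ^ M)) * (qbracket_poly (Suc h) * B) =
     (qfac q_poly h * (1 - q_poly) * (1 - q_poly ^ M)) * (qbracket_poly n * (C * (1 + q_poly ^ M)))"
    using qfac_q_poly_neq_0[of M] unfolding one_diff_q_poly_power[of n]
    by (simp add: ac_simps)
  moreover have "qfac q_poly h * (1 - q_poly) * (1 - q_poly ^ M) \<noteq> 0"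
    using qfac_q_poly_neq_0[of h] one_minus_q_poly_neq_0 one_diff_q_poly_power_neq_0[of M] M'(1)
    by (simp del: power_Suc)
  ultimately have "qbracket_poly (Suc h) * B = qbracket_poly n * (C * (1 + q_poly ^ M))"
    by (meson mult_left_cancel)
  moreover have "qbracket_poly n =
      qbracket_poly (Suc h) * (1 + q_poly ^ Suc h) + q_poly ^ (2 * Suc h)"
  proof -
    have "(1 - q_poly) * qbracket_poly (2 * Suc h) =
        (1 - q_poly) * (qbracket_poly (Suc h) * (1 + q_poly ^ Suc h))"
      unfolding one_diff_q_poly_power[symmetric] mult.assoc[symmetric]
      by (rule one_diff_power_double)
    then have "qbracket_poly (2 * Suc h) = qbracket_poly (Suc h) * (1 + q_poly ^ Suc h)"
      using one_minus_q_poly_neq_0 by (meson mult_left_cancel)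
    then show ?thesis by (simp add: h qbracket_poly_def)
  qed
  ultimately show ?thesis
    using n by (rule qbracket_dvd_cancel[rotated 2])
qed

section \<open>Assembling the congruence\<close>

lemma modulus_coprime_mult:
  "modulus_coprime n v \<Longrightarrow> modulus_coprime n w \<Longrightarrow> modulus_coprime n (v * w)"
  by (simp add: modulus_coprime_def)

lemma modulus_coprime_1: "modulus_coprime n 1"
  by (simp add: modulus_coprime_def)

lemma modulus_coprime_power: "modulus_coprime n v \<Longrightarrow> modulus_coprime n (v ^ k)"
  by (induction k) (auto intro: modulus_coprime_mult modulus_coprime_1)

lemma modulus_coprime_prod:
  "(\<And>i. modulus_coprime n (f i)) \<Longrightarrow> modulus_coprime n (\<Prod>i<(M :: nat). f i)"
  by (induction M) (auto intro: modulus_coprime_mult modulus_coprime_1)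

lemma partial_sum_cong_0:
  fixes M n :: nat
  assumes n: "n > 1" "odd n" and M: "(n + 1) div 2 \<le> M"
    and B: "qfac q_poly (2 * M) = qfac q_poly M * qfac q_poly M * B"
    and dvd: "qbracket_poly n dvd B"
  shows "ratfun_cong (\<Sum>k = 0..M. summand k) 0
           (qbracket_poly n ^ 2 * (1 - a_poly * q_poly ^ n) * (a_poly - q_poly ^ n))"
proof -
  define N where "N = (\<Prod>i<M. (q_poly - a_poly * q_poly ^ (2 * i + 2)) *
      (a_poly * q_poly - q_poly ^ (2 * i + 2)))"
  define D where "D = (\<Prod>i<M. (1 - a_poly * q_poly ^ (2 * i + 2)) * (a_poly - q_poly ^ (2 * i + 2)))"
  define G where "G = (\<Prod>i<M. 1 + q_poly ^ Suc i)"
  define u where "u = cert q_poly a_poly (q_poly ^ (2 * M + 2)) * q_poly ^ (2 * M) * N * B ^ 2"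
  define v where "v = q_poly ^ (4 * M + 4) * ((1 - a_poly * q_poly) * (q_poly - a_poly)) * (D * G ^ 4)"
  note vars = q_var_def a_var_def
  note hom = to_fract_power' to_fract_prod

  have lin: "modulus_coprime n (1 - a_poly * q_poly ^ i)" "modulus_coprime n (a_poly - q_poly ^ i)"
    if "i \<noteq> n" for i
    using modulus_coprime_one_minus[OF n that] modulus_coprime_minus[OF n that] by auto
  \<comment> \<open>The exponents in \<open>D\<close> are even, so no linear factor of the modulus
    occurs in the denominator.\<close>
  have odd_neq: "2 * i + 2 \<noteq> n" for i using n(2) by auto
  have "modulus_coprime n (- (a_poly - q_poly ^ 1))"
    using lin(2)[of 1] n(1) unfolding modulus_coprime_def coprime_minus_left_iff by simp
  then have "modulus_coprime n (q_poly - a_poly)" by simp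
  moreover have "modulus_coprime n (1 - a_poly * q_poly)"
    using lin(1)[of 1] n(1) by simp
  ultimately have v: "modulus_coprime n v"
    unfolding v_def D_def G_def
    by (intro modulus_coprime_mult modulus_coprime_power modulus_coprime_prod modulus_coprime_q
        modulus_coprime_one_plus lin n odd_neq) auto
  then have cop: "coprime v (qbracket_poly n ^ 2 * (1 - a_poly * q_poly ^ n) * (a_poly - q_poly ^ n))"
    by (simp add: modulus_coprime_def)
  \<comment> \<open>Only units are coprime to 0, and \<open>a_poly - q_poly ^ n\<close> has degree 1
    in a.\<close>
  have nonzero: "w \<noteq> 0" if "modulus_coprime n w" for w
  proof
    assume "w = 0"
    then have "is_unit (a_poly - q_poly ^ n)"
      using that by (simp add: modulus_coprime_def)
    then show False
      by (auto simp: is_unit_poly_iff a_poly_def q_poly_power)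
  qed
  have nz: "q_poly \<noteq> 0" "q_poly - a_poly \<noteq> 0" "1 - a_poly * q_poly \<noteq> 0" "G \<noteq> 0"
    using nonzero[OF v] by (auto simp: v_def)
  \<comment> \<open>The closed form needs this for every \<open>i\<close>, whereas \<open>v\<close>
    contains only linear factors with \<open>i < M\<close>; hence the return to
    \<open>lin\<close>.\<close>
  have "den_factor a_poly (q_poly ^ (2 * i + 2)) \<noteq> 0" for i
    using nonzero[OF lin(1)[OF odd_neq]] nonzero[OF lin(2)[OF odd_neq]]
      one_diff_q_poly_power_neq_0[of "2 * i + 2"]
    unfolding den_factor_def by (simp del: power_Suc)
  moreover have "den_factor a_var (q_var ^ (2 * i + 2)) =
      to_fract (den_factor a_poly (q_poly ^ (2 * i + 2)))" for i
    unfolding den_factor_def vars by (simp only: hom to_fract_mult to_fract_diff to_fract_1)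
  ultimately have den: "den_factor a_var (q_var ^ (2 * i + 2)) \<noteq> 0" for i
    by simp
  have qfac: "qfac q_var m = to_fract (qfac q_poly m)" for m
    unfolding qfac_def vars by (simp only: hom to_fract_mult to_fract_diff to_fract_1)
  have G: "(\<Prod>i<M. 1 + q_var ^ Suc i) = to_fract G"
    unfolding G_def vars by (simp only: hom to_fract_add to_fract_1)

  have "(\<Sum>k = 0..M. summand k) =
    cert q_var a_var (q_var ^ (2 * M + 2)) / (q_var ^ (4 * M + 4) * ((1 - a_var * q_var) * (q_var - a_var))) *
    (\<Prod>i<M. num_factor q_var a_var (q_var ^ (2 * i + 2)) / den_factor a_var (q_var ^ (2 * i + 2)))"
    unfolding summand_eq
  proof (rule partial_sum_closed_form)
    show "q_var \<noteq> 0" "1 - a_var * q_var \<noteq> 0" "q_var - a_var \<noteq> 0"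
      using nz unfolding vars
      by (simp_all only: to_fract_eq_0_iff not_False_eq_True flip: to_fract_mult to_fract_diff to_fract_1)
  qed (use q_var_neq_1 den in auto)
  also have "(\<Prod>i<M. num_factor q_var a_var (q_var ^ (2 * i + 2)) / den_factor a_var (q_var ^ (2 * i + 2))) =
      q_var ^ (2 * M) * (\<Prod>i<M. (q_var - a_var * q_var ^ (2 * i + 2)) * (a_var * q_var - q_var ^ (2 * i + 2))) *
      to_fract B ^ 2 /
      ((\<Prod>i<M. (1 - a_var * q_var ^ (2 * i + 2)) * (a_var - q_var ^ (2 * i + 2))) *
        (\<Prod>i<M. 1 + q_var ^ Suc i) ^ 4)"
    using qfac_q_poly_neq_0[of M] nz(4)
    by (intro prod_num_den) (simp_all only: qfac B G to_fract_mult to_fract_eq_0_iff, simp_all)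
  also have "(\<Prod>i<M. (q_var - a_var * q_var ^ (2 * i + 2)) * (a_var * q_var - q_var ^ (2 * i + 2))) =
      to_fract N"
    unfolding N_def vars by (simp only: hom to_fract_mult to_fract_diff)
  also have "(\<Prod>i<M. (1 - a_var * q_var ^ (2 * i + 2)) * (a_var - q_var ^ (2 * i + 2))) = to_fract D"
    unfolding D_def vars by (simp only: hom to_fract_mult to_fract_diff to_fract_1)
  also note G
  also have "cert q_var a_var (q_var ^ (2 * M + 2)) = to_fract (cert q_poly a_poly (q_poly ^ (2 * M + 2)))"
    unfolding cert_def vars by (simp only: hom to_fract_mult to_fract_diff to_fract_add to_fract_1)
  finally have "(\<Sum>k = 0..M. summand k) = to_fract u / to_fract v"
    unfolding u_def v_def vars
    by (simp only: hom to_fract_mult to_fract_diff to_fract_1 times_divide_times_eq mult.assoc)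

  moreover have "qbracket_poly n ^ 2 * (1 - a_poly * q_poly ^ n) * (a_poly - q_poly ^ n) dvd u"
  proof -
    obtain h where h: "n = 2 * h + 1" using n(2) by (auto elim: oddE)
    \<comment> \<open>Counting from 0, the decisive index is \<open>h = (n + 1) div 2 - 1\<close>,
      which is below \<open>M\<close> by the lower bound on \<open>M\<close>. There
      \<open>2 * h + 2 = n + 1\<close>, so both factors release one q.\<close>
    have "(q_poly - a_poly * q_poly ^ (2 * h + 2)) * (a_poly * q_poly - q_poly ^ (2 * h + 2)) dvd N"
      unfolding N_def by (rule dvd_prodI) (use M h in auto)
    moreover have "(q_poly - a_poly * q_poly ^ (2 * h + 2)) * (a_poly * q_poly - q_poly ^ (2 * h + 2)) =
        (1 - a_poly * q_poly ^ n) * (a_poly - q_poly ^ n) * q_poly ^ 2"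
      unfolding h by (simp add: algebra_simps power2_eq_square)
    ultimately have "(1 - a_poly * q_poly ^ n) * (a_poly - q_poly ^ n) dvd N"
      by (metis dvd_mult_left)
    then have "(1 - a_poly * q_poly ^ n) * (a_poly - q_poly ^ n) * qbracket_poly n ^ 2 dvd N * B ^ 2"
      using dvd by (intro mult_dvd_mono dvd_power_same)
    then have "(1 - a_poly * q_poly ^ n) * (a_poly - q_poly ^ n) * qbracket_poly n ^ 2 dvd u"
      unfolding u_def mult.assoc[of _ N] by (rule dvd_mult)
    then show ?thesis by (simp only: ac_simps)
  qed
  ultimately show ?thesis
    unfolding ratfun_cong_def using cop nonzero[OF v] by auto
qed

theorem theorem1p2:
  fixes n :: nat
  assumes "n > 1" and "odd n"
  shows "ratfun_cong (\<Sum>k = 0..(n + 1) div 2. summand k) 0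
           (qbracket_poly n ^ 2 * (1 - a_poly * q_poly ^ n) * (a_poly - q_poly ^ n))
       \<and> ratfun_cong (\<Sum>k = 0..n - 1. summand k) 0
           (qbracket_poly n ^ 2 * (1 - a_poly * q_poly ^ n) * (a_poly - q_poly ^ n))"
proof
  have binomial: "\<exists>B. qfac q_poly (2 * M) = qfac q_poly M * qfac q_poly M * B" for M
    using qfac_mult_dvd[of q_poly M M] by (auto simp: mult_2 elim: dvdE)
  show "ratfun_cong (\<Sum>k = 0..(n + 1) div 2. summand k) 0
      (qbracket_poly n ^ 2 * (1 - a_poly * q_poly ^ n) * (a_poly - q_poly ^ n))"
    using binomial[of "(n + 1) div 2"] qbracket_dvd_binomial_half[OF assms refl]
      partial_sum_cong_0[OF assms order_refl] by blast
  \<comment> \<open>An odd \<open>n > 1\<close> is at least 3, where equality holds.\<close>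
  have "(n + 1) div 2 \<le> n - 1"
    using assms by (auto elim!: oddE)
  then show "ratfun_cong (\<Sum>k = 0..n - 1. summand k) 0
      (qbracket_poly n ^ 2 * (1 - a_poly * q_poly ^ n) * (a_poly - q_poly ^ n))"
    using binomial[of "n - 1"] qbracket_dvd_binomial_pred[OF assms]
      partial_sum_cong_0[OF assms] by blast
qed

end
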